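(* Let $\psi$ be a continuously differentiable Orlicz function, let $X$ be a random variable with values in a Banach space, with $\sigma_\psi=\|X\|_\psi\in(0,\infty)$, and let $X_1,X_2,\ldots$ be i.i.d. copies of $X$. Suppose that (i) $\mathbb{E}\,\psi(|X|/\sigma_\psi)^2<\infty$, and (ii) $\mathbb{E}\big[|X|\,\psi'(|X|/\sigma)\big]<\infty$ for some $0<\sigma<\sigma_\psi$. Then, as $n\to\infty$, $$\sqrt{n}\,\big(\widehat\sigma_\psi(X_1,\ldots,X_n)-\sigma_\psi\big)\overset{d}{\longrightarrow}\mathcal{N}\left(0,\ \frac{\mathbb{E}\,\psi\big(\tfrac{|X|}{\sigma_\psi}\big)^2-1}{\Big[\mathbb{E}\,\tfrac{|X|}{\sigma_\psi^2}\,\psi'\big(\tfrac{|X|}{\sigma_\psi}\big)\Big]^2}\right).$$ Moreover, a sufficient condition for (i) and (ii) is that $\mathbb{E}\,\psi\big(\tfrac{|X|}{\sigma}+1\big)^2<\infty$ for some $0<\sigma<\sigma_\psi$.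
   Context: An Orlicz function is a function $\psi:[0,\infty)\to[0,\infty)$ that is increasing and convex, with $\psi(0)=0$ and $\psi(x)\to\infty$ as $x\to\infty$. For a random variable $X$ taking values in a Banach space with norm $|\cdot|$, the Orlicz norm is $\|X\|_\psi=\inf\{\sigma>0 : \mathbb{E}\,\psi(|X|/\sigma)\le 1\}$ (with $\inf\emptyset=\infty$). The empirical Orlicz norm of a sample $X_1,\ldots,X_n$ is $$\widehat{\sigma}_\psi(X_1,\ldots,X_n)=\inf\Big\{\sigma>0 : \frac1n\sum_{i=1}^n\psi\Big(\frac{|X_i|}{\sigma}\Big)\le 1\Big\}.$$ $\mathbb{E}\,\psi(\cdot)^2$ means $\mathbb{E}[\psi(\cdot)^2]$. *)

theory Defs
  imports "HOL-Probability.Probability"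
begin

(* Functions on [0,\<infinity>) are total functions on the reals of which only the values on {0..} matter.
   "Increasing" is taken in the weak sense. *)
definition orlicz_function :: "(real \<Rightarrow> real) \<Rightarrow> bool" where
  "orlicz_function \<psi> \<longleftrightarrow>
     (\<forall>x\<ge>0. 0 \<le> \<psi> x) \<and> mono_on {0..} \<psi> \<and> convex_on {0..} \<psi> \<and> \<psi> 0 = 0 \<and>
     filterlim \<psi> at_top at_top"

(* The expectation is a nonnegative integral, so it may be infinite; Inf {} = \<infinity> in ennreal. *)
definition orlicz_norm :: "'a measure \<Rightarrow> (real \<Rightarrow> real) \<Rightarrow> ('a \<Rightarrow> 'b::real_normed_vector) \<Rightarrow> ennreal" where
  "orlicz_norm M \<psi> X =
     Inf {ennreal \<sigma> | \<sigma>. 0 < \<sigma> \<and> (\<integral>\<^sup>+ \<omega>. ennreal (\<psi> (norm (X \<omega>) / \<sigma>)) \<partial>M) \<le> 1}"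

(* The sample is x 0, ..., x (n - 1).  For an Orlicz function the set is nonempty and
   bounded below by 0, so the infimum in the reals is the intended one. *)
definition empirical_orlicz_norm :: "(real \<Rightarrow> real) \<Rightarrow> nat \<Rightarrow> (nat \<Rightarrow> 'b::real_normed_vector) \<Rightarrow> real" where
  "empirical_orlicz_norm \<psi> n x =
     Inf {\<sigma>. 0 < \<sigma> \<and> 1 / real n * (\<Sum>i<n. \<psi> (norm (x i) / \<sigma>)) \<le> 1}"

(* N(m, v) with variance v.  The library density degenerates to 0 for standard deviation 0,
   so the Dirac case has to be given separately. *)
definition normal_distribution :: "real \<Rightarrow> real \<Rightarrow> real measure" where
  "normal_distribution m v =
     (if v = 0 then return borel m else density lborel (normal_density m (sqrt v)))"

end

theory Submission
  imports Defs
begin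

text \<open>
  As \<open>\<psi>\<close> is increasing and continuous, the empirical norm is at most \<open>r > 0\<close> iff the empirical mean of
  \<open>\<psi>(|X\<^sub>i|/r)\<close> is at most 1. Apply this at \<open>r\<^sub>n = \<sigma> + t/\<surd>n\<close>: up to normalisation, the empirical mean splits
  into the centred sum at the fixed scale \<open>\<sigma>\<close>, which obeys the central limit theorem, the centred mean of
  \<open>f\<^sub>n(X\<^sub>i) = \<surd>n (\<psi>(|X\<^sub>i|/r\<^sub>n) - \<psi>(|X\<^sub>i|/\<sigma>))\<close>, and the deterministic term \<open>E f\<^sub>n\<close>. By convexity \<open>f\<^sub>n\<close> is
  dominated by a multiple of \<open>|X| \<psi>'(|X|/\<sigma>')\<close> with \<open>\<sigma>' < \<sigma>\<close>, which is integrable but need not be square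
  integrable. This is enough for a weak law of large numbers for the array (truncation and Hoeffding's
  inequality), so the second part is negligible, and for dominated convergence, which gives
  \<open>E f\<^sub>n \<rightarrow> -tD\<close> with \<open>D = E |X|/\<sigma>\<^sup>2 \<psi>'(|X|/\<sigma>)\<close>.
\<close>

section \<open>Normal limits and Slutsky's lemma\<close>

lemma normal_distribution_real_distribution:
  assumes "0 \<le> v"
  shows "real_distribution (normal_distribution m v)"
proof (cases "v = 0")
  case True
  then show ?thesis
    by (auto simp: normal_distribution_def real_distribution_def real_distribution_axioms_def
        intro!: prob_space_return)
next
  case False
  then have "0 < v" using assms by simp
  then show ?thesis
    by (auto simp: normal_distribution_def real_distribution_def real_distribution_axioms_def
        intro!: prob_space_normal_density)
qed

text \<open>The Dirac case is fixed by scaling 0; for positive variance this is the affine image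
  rule for normal densities.\<close>

lemma distr_normal_distribution_scale:
  assumes "0 < c" "0 \<le> v"
  shows "distr (normal_distribution 0 v) borel ((*) c) = normal_distribution 0 (c\<^sup>2 * v)"
proof (cases "v = 0")
  case True
  then show ?thesis by (simp add: normal_distribution_def distr_return)
next
  case False
  then have v: "0 < v" using assms by simp
  let ?M = "density lborel (normal_density 0 (sqrt v))"
  interpret prob_space ?M using v by (intro prob_space_normal_density) simp
  have "distributed ?M lborel (\<lambda>x. x) (normal_density 0 (sqrt v))"
    by (auto simp: distributed_def distr_id2)
  from normal_density_affine[OF this, of c 0] assms v
  have "distributed ?M lborel (\<lambda>x. c * x) (normal_density 0 (c * sqrt v))" by simp
  then have "distr ?M lborel (\<lambda>x. c * x) = density lborel (normal_density 0 (c * sqrt v))"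
    by (simp add: distributed_def)
  also have "distr ?M lborel (\<lambda>x. c * x) = distr ?M borel ((*) c)"
    by (intro distr_cong) auto
  finally show ?thesis
    using v assms by (simp add: normal_distribution_def real_sqrt_mult)
qed

text \<open>For \<open>c > 0\<close> the half-lines up to \<open>x\<close> and up to
  \<open>c * x\<close> correspond under scaling. This serves twice: to pass from the standard normal
  law to variance \<open>v\<close>, and from \<open>v / D^2\<close> to \<open>v\<close>.\<close>

lemma cdf_normal_distribution_scale:
  assumes "0 < c" "0 \<le> v"
  shows "cdf (normal_distribution 0 (c\<^sup>2 * v)) (c * x) = cdf (normal_distribution 0 v) x"
proof -
  interpret real_distribution "normal_distribution 0 v"
    using assms by (intro normal_distribution_real_distribution)
  show ?thesis
    unfolding distr_normal_distribution_scale[OF assms, symmetric] cdf_def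
    using assms by (subst measure_distr) (auto intro!: arg_cong[where f="measure _"])
qed

context prob_space begin

lemma cdf_distr:
  assumes [measurable]: "Z \<in> borel_measurable M"
  shows "cdf (distr M borel Z) x = prob {\<omega> \<in> space M. Z \<omega> \<le> x}"
  unfolding cdf_def
  by (subst measure_distr) (auto intro!: arg_cong[where f=prob])

text \<open>Outside the event that |R_n| is at least \<epsilon>, adding R_n shifts W_n by less than
  \<epsilon>. So the probability is squeezed between those of W_n at points just below and just
  above \<open>l\<close>, up to the probability of that event. The moving threshold
  \<open>a n\<close> plays the role of a deterministic summand.\<close>

lemma slutsky_cdf:
  fixes W R :: "nat \<Rightarrow> 'a \<Rightarrow> real"
  assumes W [measurable]: "\<And>n. W n \<in> borel_measurable M"
    and R [measurable]: "\<And>n. R n \<in> borel_measurable M"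
    and \<nu>: "real_distribution \<nu>"
    and conv: "weak_conv_m (\<lambda>n. distr M borel (W n)) \<nu>"
    and neg: "\<And>\<epsilon>. 0 < \<epsilon> \<Longrightarrow> (\<lambda>n. prob {\<omega> \<in> space M. \<epsilon> \<le> \<bar>R n \<omega>\<bar>}) \<longlonglongrightarrow> 0"
    and a: "a \<longlonglongrightarrow> l" and cont: "isCont (cdf \<nu>) l"
  shows "(\<lambda>n. prob {\<omega> \<in> space M. W n \<omega> + R n \<omega> \<le> a n}) \<longlonglongrightarrow> cdf \<nu> l"
proof (rule LIMSEQ_I)
  interpret \<nu>: real_distribution \<nu> by fact
  fix \<eta> :: real assume \<eta>: "0 < \<eta>"
  obtain d where d: "0 < d" "\<And>x. \<bar>x - l\<bar> < d \<Longrightarrow> \<bar>cdf \<nu> x - cdf \<nu> l\<bar> < \<eta> / 3"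
    using cont[unfolded continuous_at_eps_delta, rule_format, of "\<eta> / 3"] \<eta>
    by (auto simp: dist_real_def)
  \<comment> \<open>A monotone function has countably many discontinuities, so continuity points
    \<open>b\<close> and \<open>c\<close>, where weak convergence can be applied, exist arbitrarily
    close to \<open>l\<close> on either side.\<close>
  have count: "countable {x. \<not> isCont (cdf \<nu>) x}"
    by (intro mono_ctble_discont monoI \<nu>.cdf_nondecreasing)
  obtain b where b: "l - d < b" "b < l" "isCont (cdf \<nu>) b"
    using open_minus_countable[OF count, of "{l - d<..<l}"] d by auto
  obtain c where c: "l < c" "c < l + d" "isCont (cdf \<nu>) c"
    using open_minus_countable[OF count, of "{l<..<l + d}"] d by auto
  \<comment> \<open>Two errors have to fit between \<open>l\<close> and \<open>b\<close> or
    \<open>c\<close>: one \<epsilon> for \<open>R n\<close> and one for the distance of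
    \<open>a n\<close> from \<open>l\<close>.\<close>
  define \<epsilon> where "\<epsilon> = min (l - b) (c - l) / 2"
  have \<epsilon>: "0 < \<epsilon>" "b + \<epsilon> \<le> l - \<epsilon>" "l + \<epsilon> \<le> c - \<epsilon>"
    using b c by (auto simp: \<epsilon>_def min_def field_simps)
  have W_conv: "(\<lambda>n. prob {\<omega> \<in> space M. W n \<omega> \<le> x}) \<longlonglongrightarrow> cdf \<nu> x" if "isCont (cdf \<nu>) x" for x
    using conv that by (simp add: weak_conv_m_def weak_conv_def cdf_distr)
  have "eventually (\<lambda>n. \<bar>a n - l\<bar> < \<epsilon>) sequentially"
    using tendstoD[OF a \<epsilon>(1)] by (simp add: dist_real_def)
  moreover have "eventually (\<lambda>n. prob {\<omega> \<in> space M. \<epsilon> \<le> \<bar>R n \<omega>\<bar>} < \<eta> / 3) sequentially"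
    using neg[OF \<epsilon>(1)] \<eta> by (intro order_tendstoD) auto
  moreover have "eventually (\<lambda>n. cdf \<nu> b - \<eta> / 3 < prob {\<omega> \<in> space M. W n \<omega> \<le> b}) sequentially"
    using W_conv[OF b(3)] \<eta> by (intro order_tendstoD) auto
  moreover have "eventually (\<lambda>n. prob {\<omega> \<in> space M. W n \<omega> \<le> c} < cdf \<nu> c + \<eta> / 3) sequentially"
    using W_conv[OF c(3)] \<eta> by (intro order_tendstoD) auto
  ultimately have "eventually (\<lambda>n.
      norm (prob {\<omega> \<in> space M. W n \<omega> + R n \<omega> \<le> a n} - cdf \<nu> l) < \<eta>) sequentially"
  proof eventually_elim
    case (elim n)
    let ?E = "{\<omega> \<in> space M. \<epsilon> \<le> \<bar>R n \<omega>\<bar>}"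
    have "prob {\<omega> \<in> space M. W n \<omega> \<le> b} \<le> prob ({\<omega> \<in> space M. W n \<omega> + R n \<omega> \<le> a n} \<union> ?E)"
      using elim \<epsilon> by (intro finite_measure_mono) auto
    also have "\<dots> \<le> prob {\<omega> \<in> space M. W n \<omega> + R n \<omega> \<le> a n} + prob ?E"
      by (intro measure_Un_le) auto
    finally have lower: "prob {\<omega> \<in> space M. W n \<omega> \<le> b}
        \<le> prob {\<omega> \<in> space M. W n \<omega> + R n \<omega> \<le> a n} + prob ?E" .
    have "prob {\<omega> \<in> space M. W n \<omega> + R n \<omega> \<le> a n} \<le> prob ({\<omega> \<in> space M. W n \<omega> \<le> c} \<union> ?E)"
      using elim \<epsilon> by (intro finite_measure_mono) auto
    also have "\<dots> \<le> prob {\<omega> \<in> space M. W n \<omega> \<le> c} + prob ?E"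
      by (intro measure_Un_le) auto
    finally have upper: "prob {\<omega> \<in> space M. W n \<omega> + R n \<omega> \<le> a n}
        \<le> prob {\<omega> \<in> space M. W n \<omega> \<le> c} + prob ?E" .
    have "\<bar>cdf \<nu> b - cdf \<nu> l\<bar> < \<eta> / 3" "\<bar>cdf \<nu> c - cdf \<nu> l\<bar> < \<eta> / 3"
      using b c by (intro d(2); simp add: abs_less_iff)+
    with lower upper elim show ?case unfolding real_norm_def by linarith
  qed
  then show "\<exists>n0. \<forall>n\<ge>n0.
      norm (prob {\<omega> \<in> space M. W n \<omega> + R n \<omega> \<le> a n} - cdf \<nu> l) < \<eta>"
    by (simp add: eventually_sequentially)
qed

end

section \<open>Limit theorems for i.i.d. sequences\<close>

text \<open>The common law \<mu> is a parameter, so that moment conditions can be stated on the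
  space of values without reference to an index or to the underlying probability space.\<close>

locale iid_sequence = prob_space M for M :: "'a measure" +
  fixes Y :: "nat \<Rightarrow> 'a \<Rightarrow> 'b::topological_space" and \<mu> :: "'b measure"
  assumes indep: "indep_vars (\<lambda>_. borel) Y UNIV"
    and ident: "\<And>i. distr M borel (Y i) = \<mu>"
begin

lemma measurable_Y [measurable]: "Y i \<in> borel_measurable M"
  using indep by (simp add: indep_vars_def2)

lemma sets_\<mu> [measurable_cong, simp]: "sets \<mu> = sets borel"
  using ident[of 0] by auto

sublocale \<mu>: prob_space \<mu>
  using prob_space_distr[OF measurable_Y, of 0] by (simp add: ident)

lemma expectation_Y:
  fixes f :: "'b \<Rightarrow> real"
  assumes "f \<in> borel_measurable borel"
  shows "expectation (\<lambda>\<omega>. f (Y i \<omega>)) = integral\<^sup>L \<mu> f"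
  using assms by (subst ident[of i, symmetric], subst integral_distr) auto

lemma integrable_Y:
  fixes f :: "'b \<Rightarrow> real"
  assumes "f \<in> borel_measurable borel"
  shows "integrable M (\<lambda>\<omega>. f (Y i \<omega>)) \<longleftrightarrow> integrable \<mu> f"
  using assms by (subst ident[of i, symmetric], subst integrable_distr_eq) auto

lemma indep_fun:
  assumes "f \<in> borel_measurable borel"
  shows "indep_vars (\<lambda>_. borel) (\<lambda>i \<omega>. f (Y i \<omega>)) I"
  by (intro indep_vars_subset[OF indep_vars_compose2[OF indep]]) (use assms in auto)

text \<open>The summands change with \<open>n\<close>, so a law of large numbers for one fixed
  function does not apply. Hoeffding's inequality gives an exponential bound that depends on the
  array only through its uniform bound.\<close>

lemma weak_law_bounded:
  fixes f :: "nat \<Rightarrow> 'b \<Rightarrow> real"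
  assumes f [measurable]: "\<And>n. f n \<in> borel_measurable borel"
    and bound: "\<And>n x. \<bar>f n x\<bar> \<le> K" and \<epsilon>: "0 < \<epsilon>"
  shows "(\<lambda>n. prob {\<omega> \<in> space M. \<epsilon> \<le> \<bar>(\<Sum>i<n. f n (Y i \<omega>)) / real n - integral\<^sup>L \<mu> (f n)\<bar>}) \<longlonglongrightarrow> 0"
proof (rule tendsto_sandwich[OF _ _ tendsto_const])
  \<comment> \<open>The added 1 keeps the interval from \<open>- L\<close> to \<open>L\<close>
    nondegenerate when \<open>K = 0\<close>; its length is a divisor in the Hoeffding
    exponent.\<close>
  define L where "L = \<bar>K\<bar> + 1"
  have L: "0 < L" "\<And>n x. \<bar>f n x\<bar> \<le> L"
    unfolding L_def using bound by (auto intro: order_trans[OF bound])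
  show "eventually (\<lambda>n. prob {\<omega> \<in> space M.
      \<epsilon> \<le> \<bar>(\<Sum>i<n. f n (Y i \<omega>)) / real n - integral\<^sup>L \<mu> (f n)\<bar>}
        \<le> 2 * exp (-2 * real n * \<epsilon>\<^sup>2 / (L - (- L))\<^sup>2)) sequentially"
    using eventually_gt_at_top[of 0]
  proof eventually_elim
    case (elim n)
    have eq: "distr M borel (\<lambda>\<omega>. f n (Y i \<omega>)) = distr M borel (\<lambda>\<omega>. f n (Y 0 \<omega>))" for i
      using distr_distr[of "f n" borel borel "Y i" M] distr_distr[of "f n" borel borel "Y 0" M]
      by (simp add: ident o_def)
    interpret H: Hoeffding_ineq_iid M "{..<n}" "\<lambda>i \<omega>. f n (Y i \<omega>)" "\<lambda>\<omega>. f n (Y 0 \<omega>)" "- L" L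
      "expectation (\<lambda>\<omega>. f n (Y 0 \<omega>))"
    proof unfold_locales
      show "AE x in M. f n (Y 0 x) \<in> {- L..L}" using L(2) by (simp add: abs_le_iff minus_le_iff[of L])
      show "indep_vars (\<lambda>_. borel) (\<lambda>i \<omega>. f n (Y i \<omega>)) {..<n}"
        by (rule indep_fun) (rule f)
      show "distr M borel (\<lambda>\<omega>. f n (Y i \<omega>)) = distr M borel (\<lambda>\<omega>. f n (Y 0 \<omega>))" for i
        by (rule eq)
    qed auto
    show ?case
      using H.Hoeffding_ineq_abs_ge'[of \<epsilon>] \<epsilon> L elim
      by (simp add: expectation_Y[OF f] lessThan_empty_iff)
  qed
  show "(\<lambda>n. 2 * exp (-2 * real n * \<epsilon>\<^sup>2 / (L - (- L))\<^sup>2)) \<longlonglongrightarrow> 0"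
  proof -
    define c where "c = 2 * \<epsilon>\<^sup>2 / (L - (- L))\<^sup>2"
    have c: "0 < c" using \<epsilon> L by (simp add: c_def)
    have "((\<lambda>n. exp (- (c * real n))) \<longlongrightarrow> 0) sequentially"
      using c by (intro filterlim_compose[OF exp_at_bot] filterlim_uminus_at_bot[THEN iffD2])
        (auto intro!: filterlim_tendsto_pos_mult_at_top filterlim_real_sequentially)
    from tendsto_mult_left[OF this, of 2] show ?thesis
      by (simp add: c_def mult_ac)
  qed
qed (simp_all add: eventually_sequentially)

text \<open>Truncation follows the size of \<open>g\<close> rather than of \<open>f n\<close>, so
  one level \<open>k\<close> serves all \<open>n\<close>. Where \<open>g \<le> k\<close> the array
  is bounded; where \<open>g > k\<close> both the empirical mean and the expectation are controlled
  by the tail integral of \<open>g\<close>, and Markov's inequality applies.\<close>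

lemma weak_law_dominated:
  fixes f :: "nat \<Rightarrow> 'b \<Rightarrow> real" and g :: "'b \<Rightarrow> real"
  assumes f [measurable]: "\<And>n. f n \<in> borel_measurable borel"
    and g [measurable]: "g \<in> borel_measurable borel"
    and bound: "\<And>n x. \<bar>f n x\<bar> \<le> g x"
    and int: "integrable \<mu> g" and \<epsilon>: "0 < \<epsilon>"
  shows "(\<lambda>n. prob {\<omega> \<in> space M. \<epsilon> \<le> \<bar>(\<Sum>i<n. f n (Y i \<omega>)) / real n - integral\<^sup>L \<mu> (f n)\<bar>}) \<longlonglongrightarrow> 0"
proof (rule LIMSEQ_I)
  fix \<eta> :: real assume \<eta>: "0 < \<eta>"
  have g_nonneg: "0 \<le> g x" for x using bound[of 0 x] by linarith
  let ?h = "\<lambda>K x. g x * indicator {x. K < g x} x"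
  have "(\<lambda>k. integral\<^sup>L \<mu> (?h (real k))) \<longlonglongrightarrow> (\<integral>x. 0 \<partial>\<mu>)"
  proof (rule integral_dominated_convergence[where w=g])
    show "AE x in \<mu>. (\<lambda>k. ?h (real k) x) \<longlonglongrightarrow> 0"
    proof (rule AE_I2)
      fix x
      obtain k0 where "g x \<le> real k0" using real_arch_simple by blast
      then have "eventually (\<lambda>k. ?h (real k) x = 0) sequentially"
        by (intro eventually_sequentiallyI[of k0]) (auto simp: indicator_def)
      then show "(\<lambda>k. ?h (real k) x) \<longlonglongrightarrow> 0" by (rule tendsto_eventually)
    qed
  qed (use g_nonneg int in \<open>auto simp: indicator_def\<close>)
  \<comment> \<open>The 8 comes from Markov's inequality at level \<epsilon>/2 for a variable whose
    mean is twice this integral: the resulting probability is below \<eta>/2.\<close>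
  then have "eventually (\<lambda>k. integral\<^sup>L \<mu> (?h (real k)) < \<epsilon> * \<eta> / 8) sequentially"
    using \<epsilon> \<eta> by (intro order_tendstoD) auto
  then obtain k where k: "integral\<^sup>L \<mu> (?h (real k)) < \<epsilon> * \<eta> / 8"
    by (auto dest: eventually_happens)
  define h where "h = ?h (real k)"
  define f1 where "f1 n x = f n x * indicator {x. g x \<le> real k} x" for n x
  define f2 where "f2 n x = f n x * indicator {x. real k < g x} x" for n x
  have [measurable]: "h \<in> borel_measurable borel" "f1 n \<in> borel_measurable borel"
    "f2 n \<in> borel_measurable borel" for n
    unfolding h_def f1_def f2_def by measurable
  have split: "f n x = f1 n x + f2 n x" for n x
    by (auto simp: f1_def f2_def indicator_def)
  have f1_le: "\<bar>f1 n x\<bar> \<le> real k" for n x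
    using bound[of n x] by (auto simp: f1_def indicator_def)
  have f2_le: "\<bar>f2 n x\<bar> \<le> h x" for n x
    using bound[of n x] by (auto simp: f2_def h_def indicator_def)
  have h_nonneg: "0 \<le> h x" for x using f2_le[of 0 x] by linarith
  have h_int: "integrable \<mu> h"
    by (rule Bochner_Integration.integrable_bound[OF int])
       (auto simp: h_def indicator_def)
  have f2_int: "integrable \<mu> (f2 n)" for n
    by (rule Bochner_Integration.integrable_bound[OF h_int])
       (use f2_le h_nonneg in auto)
  have f1_int: "integrable \<mu> (f1 n)" for n
    by (rule \<mu>.integrable_const_bound[where B="real k"]) (use f1_le in auto)
  have "eventually (\<lambda>n. prob {\<omega> \<in> space M.
      \<epsilon> / 2 \<le> \<bar>(\<Sum>i<n. f1 n (Y i \<omega>)) / real n - integral\<^sup>L \<mu> (f1 n)\<bar>} < \<eta> / 2) sequentially"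
    using weak_law_bounded[of f1 "real k" "\<epsilon> / 2"] f1_le \<epsilon> \<eta> by (intro order_tendstoD) auto
  then have "eventually (\<lambda>n. norm (prob {\<omega> \<in> space M.
      \<epsilon> \<le> \<bar>(\<Sum>i<n. f n (Y i \<omega>)) / real n - integral\<^sup>L \<mu> (f n)\<bar>} - 0) < \<eta>) sequentially"
    using eventually_gt_at_top[of 0]
  proof eventually_elim
    case (elim n)
    \<comment> \<open>A pointwise majorant of the centred mean of the tails \<open>f2 n\<close>. The
      second summand pays for the centring.\<close>
    define u where "u \<omega> = (\<Sum>i<n. h (Y i \<omega>)) / real n + integral\<^sup>L \<mu> h" for \<omega>
    have [measurable]: "u \<in> borel_measurable M" unfolding u_def by measurable
    have hY: "integrable M (\<lambda>\<omega>. h (Y i \<omega>))" for i using h_int by (simp add: integrable_Y)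
    have u_int: "integrable M u" unfolding u_def using hY by auto
    have "expectation u = 2 * integral\<^sup>L \<mu> h"
      unfolding u_def using hY elim by (simp add: expectation_Y prob_space)
    then have u_small: "expectation u / (\<epsilon> / 2) < \<eta> / 2"
      using k \<epsilon> by (simp add: h_def field_simps)
    let ?S1 = "{\<omega> \<in> space M. \<epsilon> / 2 \<le> \<bar>(\<Sum>i<n. f1 n (Y i \<omega>)) / real n - integral\<^sup>L \<mu> (f1 n)\<bar>}"
    let ?S2 = "{\<omega> \<in> space M. \<epsilon> / 2 \<le> u \<omega>}"
    have tail: "\<bar>(\<Sum>i<n. f2 n (Y i \<omega>)) / real n - integral\<^sup>L \<mu> (f2 n)\<bar> \<le> u \<omega>" for \<omega>
    proof -
      have "\<bar>\<Sum>i<n. f2 n (Y i \<omega>)\<bar> \<le> (\<Sum>i<n. h (Y i \<omega>))"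
        by (rule order_trans[OF sum_abs]) (intro sum_mono f2_le)
      then have "\<bar>(\<Sum>i<n. f2 n (Y i \<omega>)) / real n\<bar> \<le> (\<Sum>i<n. h (Y i \<omega>)) / real n"
        by (simp add: abs_divide divide_right_mono)
      moreover have "\<bar>integral\<^sup>L \<mu> (f2 n)\<bar> \<le> integral\<^sup>L \<mu> h"
        by (rule order_trans[OF integral_abs_bound])
           (intro integral_mono integrable_abs f2_int h_int f2_le)
      ultimately show ?thesis unfolding u_def by linarith
    qed
    have split_dev: "(\<Sum>i<n. f n (Y i \<omega>)) / real n - integral\<^sup>L \<mu> (f n)
      = ((\<Sum>i<n. f1 n (Y i \<omega>)) / real n - integral\<^sup>L \<mu> (f1 n))
        + ((\<Sum>i<n. f2 n (Y i \<omega>)) / real n - integral\<^sup>L \<mu> (f2 n))" for \<omega>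
    proof -
      have "integral\<^sup>L \<mu> (f n) = integral\<^sup>L \<mu> (f1 n) + integral\<^sup>L \<mu> (f2 n)"
        unfolding split[abs_def] using f1_int f2_int by simp
      then show ?thesis by (simp add: split sum.distrib add_divide_distrib)
    qed
    have "prob {\<omega> \<in> space M. \<epsilon> \<le> \<bar>(\<Sum>i<n. f n (Y i \<omega>)) / real n - integral\<^sup>L \<mu> (f n)\<bar>}
        \<le> prob (?S1 \<union> ?S2)"
    proof (intro finite_measure_mono subsetI)
      fix \<omega>
      assume "\<omega> \<in> {\<omega> \<in> space M. \<epsilon> \<le> \<bar>(\<Sum>i<n. f n (Y i \<omega>)) / real n - integral\<^sup>L \<mu> (f n)\<bar>}"
      then have \<omega>: "\<omega> \<in> space M"
        and "\<epsilon> \<le> \<bar>(\<Sum>i<n. f n (Y i \<omega>)) / real n - integral\<^sup>L \<mu> (f n)\<bar>" by auto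
      then have "\<epsilon> / 2 \<le> \<bar>(\<Sum>i<n. f1 n (Y i \<omega>)) / real n - integral\<^sup>L \<mu> (f1 n)\<bar> \<or> \<epsilon> / 2 \<le> u \<omega>"
        using tail[of \<omega>] unfolding split_dev by linarith
      with \<omega> show "\<omega> \<in> ?S1 \<union> ?S2" by simp
    qed measurable
    also have "\<dots> \<le> prob ?S1 + prob ?S2" by (intro measure_Un_le) auto
    also have "prob ?S2 \<le> expectation u / (\<epsilon> / 2)"
      using u_int \<epsilon> order_trans[OF abs_ge_zero tail]
      by (intro integral_Markov_inequality_measure[where A="{}"]) auto
    finally show ?case using elim u_small by simp
  qed
  then show "\<exists>n0. \<forall>n\<ge>n0. norm (prob {\<omega> \<in> space M.
      \<epsilon> \<le> \<bar>(\<Sum>i<n. f n (Y i \<omega>)) / real n - integral\<^sup>L \<mu> (f n)\<bar>} - 0) < \<eta>"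
    by (simp add: eventually_sequentially)
qed

text \<open>For positive variance the classical theorem for standardised sums is rescaled through
  cdfs. For variance 0 every summand equals its mean almost surely, and both the sums and the limit
  are Dirac at 0.\<close>

lemma central_limit:
  fixes f :: "'b \<Rightarrow> real"
  assumes f [measurable]: "f \<in> borel_measurable borel"
    and sq: "integrable \<mu> (\<lambda>x. (f x)\<^sup>2)"
  shows "weak_conv_m (\<lambda>n. distr M borel (\<lambda>\<omega>. (\<Sum>i<n. f (Y i \<omega>) - integral\<^sup>L \<mu> f) / sqrt (real n)))
    (normal_distribution 0 (\<mu>.variance f))"
proof -
  define m where "m = integral\<^sup>L \<mu> f"
  define v where "v = \<mu>.variance f"
  have int: "integrable \<mu> f"
    by (rule \<mu>.square_integrable_imp_integrable[OF _ sq]) simp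
  have cint: "integrable \<mu> (\<lambda>x. (f x - m)\<^sup>2)"
    using int sq by (simp add: power2_diff)
  let ?S = "\<lambda>n \<omega>. \<Sum>i<n. f (Y i \<omega>) - m"
  have v_nonneg: "0 \<le> v" by (simp add: v_def)
  have "weak_conv_m (\<lambda>n. distr M borel (\<lambda>\<omega>. ?S n \<omega> / sqrt (real n))) (normal_distribution 0 v)"
  proof (cases "v = 0")
    case True
    have "AE x in \<mu>. (f x - m)\<^sup>2 = 0"
      using True cint by (subst (asm) v_def, subst (asm) integral_nonneg_eq_0_iff_AE) (auto simp: m_def)
    then have "AE x in \<mu>. f x = m" by simp
    then have "AE x in distr M borel (Y i). f x = m" for i by (simp only: ident)
    then have "AE \<omega> in M. f (Y i \<omega>) = m" for i by (subst (asm) AE_distr_iff) auto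
    then have "AE \<omega> in M. \<forall>i. f (Y i \<omega>) = m" by (simp add: AE_all_countable)
    then have "distr M borel (\<lambda>\<omega>. ?S n \<omega> / sqrt (real n)) = distr M borel (\<lambda>_. 0)" for n
      by (intro distr_cong_AE) (auto elim: eventually_mono)
    moreover have "distr M borel (\<lambda>_. 0::real) = normal_distribution 0 v"
      using True by (simp add: normal_distribution_def distr_const)
    ultimately show ?thesis by (simp add: weak_conv_m_def weak_conv_def)
  next
    case False
    then have v: "0 < v" using v_nonneg by simp
    define \<sigma> where "\<sigma> = sqrt v"
    have \<sigma>: "0 < \<sigma>" "\<sigma>\<^sup>2 = v" using v by (auto simp: \<sigma>_def)
    have mean: "expectation (\<lambda>\<omega>. f (Y i \<omega>) - m) = 0" for i
      using int by (simp add: integrable_Y expectation_Y m_def prob_space)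
    have clt: "weak_conv_m (\<lambda>n. distr M borel (\<lambda>\<omega>. ?S n \<omega> / sqrt (real n * \<sigma>\<^sup>2))) std_normal_distribution"
    proof (rule central_limit_theorem_zero_mean[where \<mu>="distr \<mu> borel (\<lambda>x. f x - m)"])
      show "indep_vars (\<lambda>i. borel) (\<lambda>i \<omega>. f (Y i \<omega>) - m) UNIV"
        by (rule indep_fun[of "\<lambda>x. f x - m"]) simp
      show "integrable M (\<lambda>\<omega>. (f (Y i \<omega>) - m)\<^sup>2)" for i
        using cint by (subst integrable_Y[of "\<lambda>x. (f x - m)\<^sup>2"]) auto
      show "variance (\<lambda>\<omega>. f (Y i \<omega>) - m) = \<sigma>\<^sup>2" for i
        unfolding mean \<sigma>(2) v_def using expectation_Y[of "\<lambda>x. (f x - m)\<^sup>2" i] by (simp add: m_def)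
      show "distr M borel (\<lambda>\<omega>. f (Y i \<omega>) - m) = distr \<mu> borel (\<lambda>x. f x - m)" for i
        by (subst ident[of i, symmetric], subst distr_distr) (auto simp: o_def)
    qed (use mean \<sigma> in auto)
    have std: "std_normal_distribution = normal_distribution 0 1"
      by (simp add: normal_distribution_def)
    have scale_clt: "cdf (distr M borel (\<lambda>\<omega>. ?S n \<omega> / sqrt (real n))) (\<sigma> * x)
      = cdf (distr M borel (\<lambda>\<omega>. ?S n \<omega> / sqrt (real n * \<sigma>\<^sup>2))) x" for n x
    proof -
      have "?S n \<omega> / sqrt (real n) \<le> \<sigma> * x \<longleftrightarrow> ?S n \<omega> / sqrt (real n * \<sigma>\<^sup>2) \<le> x" for \<omega>
      proof -
        have "?S n \<omega> / sqrt (real n) = \<sigma> * (?S n \<omega> / sqrt (real n * \<sigma>\<^sup>2))"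
          using \<sigma>(1) by (simp add: real_sqrt_mult)
        then show ?thesis using \<sigma>(1) by (simp only: mult_le_cancel_left_pos)
      qed
      then show ?thesis by (simp add: cdf_distr)
    qed
    have scale_normal: "cdf (normal_distribution 0 v) (\<sigma> * x) = cdf std_normal_distribution x" for x
      using cdf_normal_distribution_scale[of \<sigma> 1 x] \<sigma> by (simp add: std)
    have scaled:
      "cdf (distr M borel (\<lambda>\<omega>. ?S n \<omega> / sqrt (real n))) y
        = cdf (distr M borel (\<lambda>\<omega>. ?S n \<omega> / sqrt (real n * \<sigma>\<^sup>2))) (y / \<sigma>)"
      "cdf (normal_distribution 0 v) y = cdf std_normal_distribution (y / \<sigma>)" for n y
      using scale_clt[of n "y / \<sigma>"] scale_normal[of "y / \<sigma>"] \<sigma>(1) by simp_all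
    show ?thesis
      unfolding weak_conv_m_def weak_conv_def
    proof (intro allI impI)
      fix y assume y: "isCont (cdf (normal_distribution 0 v)) y"
      \<comment> \<open>Weak convergence speaks only about continuity points of the limit, so these
        have to be carried along by the rescaling too.\<close>
      have "isCont (\<lambda>x. cdf (normal_distribution 0 v) (\<sigma> * x)) (y / \<sigma>)"
        by (rule isCont_o2[where g="cdf (normal_distribution 0 v)"]) (use y \<sigma>(1) in simp_all)
      then have "isCont (cdf std_normal_distribution) (y / \<sigma>)"
        unfolding scale_normal .
      then show "(\<lambda>n. cdf (distr M borel (\<lambda>\<omega>. ?S n \<omega> / sqrt (real n))) y)
          \<longlonglongrightarrow> cdf (normal_distribution 0 v) y"
        using clt by (simp add: scaled weak_conv_m_def weak_conv_def)
    qed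
  qed
  then show ?thesis by (simp add: m_def v_def)
qed

end

section \<open>Smooth Orlicz functions\<close>

text \<open>Only values on \<open>{0..}\<close> are meaningful, so the derivative is taken within
  that set and is one-sided at 0.\<close>

locale smooth_orlicz =
  fixes \<psi> \<psi>' :: "real \<Rightarrow> real"
  assumes orlicz: "orlicz_function \<psi>"
    and deriv: "\<And>x. 0 \<le> x \<Longrightarrow> (\<psi> has_real_derivative \<psi>' x) (at x within {0..})"
    and cont_deriv: "continuous_on {0..} \<psi>'"
begin

lemma nonneg: "0 \<le> x \<Longrightarrow> 0 \<le> \<psi> x"
  and zero: "\<psi> 0 = 0"
  and mono: "0 \<le> x \<Longrightarrow> x \<le> y \<Longrightarrow> \<psi> x \<le> \<psi> y"
  and convex: "convex_on {0..} \<psi>"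
  and at_top: "filterlim \<psi> at_top at_top"
  using orlicz by (auto simp: orlicz_function_def mono_on_def)

lemma cont: "continuous_on {0..} \<psi>"
  by (rule DERIV_continuous_on) (use deriv in auto)

lemma continuous_norm: "0 < s \<Longrightarrow> continuous_on UNIV (\<lambda>x::'b::real_normed_vector. \<psi> (norm x / s))"
  by (rule continuous_on_compose2[OF cont]) (auto intro!: continuous_intros)

lemma continuous_deriv_norm:
  "0 < s \<Longrightarrow> continuous_on UNIV (\<lambda>x::'b::real_normed_vector. \<psi>' (norm x / s))"
  by (rule continuous_on_compose2[OF cont_deriv]) (auto intro!: continuous_intros)

lemma measurable_norm [measurable]:
  "0 < s \<Longrightarrow> (\<lambda>x::'b::real_normed_vector. \<psi> (norm x / s)) \<in> borel_measurable borel"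
  by (intro borel_measurable_continuous_onI continuous_norm)

lemma measurable_deriv_norm [measurable]:
  "0 < s \<Longrightarrow> (\<lambda>x::'b::real_normed_vector. \<psi>' (norm x / s)) \<in> borel_measurable borel"
  by (intro borel_measurable_continuous_onI continuous_deriv_norm)

section \<open>Tangent lines and bounds by the derivative\<close>

lemma tangent:
  assumes "0 < x" "0 \<le> y"
  shows "\<psi>' x * (y - x) \<le> \<psi> y - \<psi> x"
  by (rule convex_on_imp_above_tangent[OF convex])
     (use assms deriv[of x] in \<open>auto simp: interior_real_atLeast\<close>)

text \<open>Adding the tangent inequalities at \<open>x\<close> and at \<open>y\<close> cancels the
  values of \<psi>.\<close>

lemma deriv_mono:
  assumes "0 < x" "x \<le> y"
  shows "\<psi>' x \<le> \<psi>' y"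
proof (cases "x = y")
  case False
  have "\<psi>' x * (y - x) \<le> \<psi>' y * (y - x)"
    using tangent[of x y] tangent[of y x] assms by (simp add: algebra_simps)
  then show ?thesis using False assms by simp
qed simp

lemma deriv_nonneg:
  assumes "0 < x"
  shows "0 \<le> \<psi>' x"
proof -
  have "0 \<le> \<psi>' x * x"
    using tangent[of x 0] nonneg[of x] assms zero by (simp add: algebra_simps)
  then show ?thesis using assms by (simp add: zero_le_mult_iff)
qed

lemma le_deriv:
  assumes "0 \<le> x"
  shows "\<psi> x \<le> x * \<psi>' x"
  using tangent[of x 0] zero assms by (cases "x = 0") (auto simp: algebra_simps)

text \<open>The tangent at the larger of the two points bounds the increment by its slope, and
  slopes increase up to \<open>z\<close>.\<close>

lemma diff_le_deriv:
  assumes "0 \<le> x" "x \<le> z" "0 \<le> y" "y \<le> z" "0 < z"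
  shows "\<bar>\<psi> x - \<psi> y\<bar> \<le> \<psi>' z * \<bar>x - y\<bar>"
proof -
  have *: "\<psi> b - \<psi> a \<le> \<psi>' z * (b - a)" if "0 \<le> a" "a \<le> b" "b \<le> z" for a b
  proof (cases "b = 0")
    case False
    have "\<psi> b - \<psi> a \<le> \<psi>' b * (b - a)"
      using tangent[of b a] that False by (simp add: algebra_simps)
    also have "\<dots> \<le> \<psi>' z * (b - a)"
      using that False by (intro mult_right_mono deriv_mono) auto
    finally show ?thesis .
  qed (use that in auto)
  show ?thesis
    using *[of x y] *[of y x] mono[of x y] mono[of y x] assms by (cases "x \<le> y") auto
qed

text \<open>Both arguments lie below \<open>u / s0\<close>, where \<open>\<psi>' (u / s0)\<close> is
  a Lipschitz constant, and 1/s and 1/r differ by at most |s - r|/s0^2. The bound separates the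
  change of scale from a function of \<open>u\<close> alone: it yields continuity of the mean in the
  scale, and domination that survives a factor sqrt n when |s - r| is of order 1/sqrt n.\<close>

lemma scale_diff_le:
  assumes "0 < s0" "s0 \<le> s" "s0 \<le> r" "0 \<le> u"
  shows "\<bar>\<psi> (u / s) - \<psi> (u / r)\<bar> \<le> \<bar>s - r\<bar> / s0\<^sup>2 * (u * \<psi>' (u / s0))"
proof (cases "u = 0")
  case False
  then have u: "0 < u" using assms by simp
  have "\<bar>\<psi> (u / s) - \<psi> (u / r)\<bar> \<le> \<psi>' (u / s0) * \<bar>u / s - u / r\<bar>"
    using assms u by (intro diff_le_deriv) (auto intro!: divide_left_mono)
  also have "u / s - u / r = u * ((r - s) / (s * r))"
    using assms by (simp add: field_simps)
  also have "\<bar>u * ((r - s) / (s * r))\<bar> = u * (\<bar>s - r\<bar> / (s * r))"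
    using assms u by (simp add: abs_mult abs_divide abs_minus_commute)
  also have "\<psi>' (u / s0) * \<dots> \<le> \<psi>' (u / s0) * (u * (\<bar>s - r\<bar> / s0\<^sup>2))"
    unfolding power2_eq_square using assms u
    by (intro mult_left_mono divide_left_mono mult_mono deriv_nonneg) auto
  finally show ?thesis by (simp add: mult_ac)
qed simp

lemma scale_antimono:
  assumes "0 < s" "s \<le> r" "0 \<le> u"
  shows "\<psi> (u / r) \<le> \<psi> (u / s)"
  using assms by (intro mono divide_left_mono) auto

lemma le_scale_deriv:
  assumes "0 < s0" "s0 \<le> s" "0 \<le> u"
  shows "\<psi> (u / s) \<le> u * \<psi>' (u / s0) / s0"
proof -
  have "\<psi> (u / s) \<le> \<psi> (u / s0)" using assms by (intro scale_antimono)
  also have "\<dots> \<le> u / s0 * \<psi>' (u / s0)" using assms by (intro le_deriv) auto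
  finally show ?thesis by simp
qed

text \<open>Take \<open>a\<close> with \<open>\<psi> a \<ge> 1\<close>. Beyond \<open>a\<close>,
  convexity and \<open>\<psi> 0 = 0\<close> put \<open>\<psi> x\<close> above x/a; up to
  \<open>a\<close> the constant term is enough. This later absorbs a factor |X| into \<psi>.\<close>

lemma linear_growth:
  obtains c where "0 \<le> c" "\<And>x. 0 \<le> x \<Longrightarrow> x \<le> c * (1 + \<psi> x)"
proof -
  obtain a where a: "0 < a" "1 \<le> \<psi> a"
  proof -
    have "eventually (\<lambda>x. 0 < x \<and> 1 \<le> \<psi> x) at_top"
      using at_top eventually_gt_at_top[of 0] by (auto simp: filterlim_at_top eventually_conj_iff)
    then show ?thesis using that by (auto dest: eventually_happens)
  qed
  have "x \<le> a * (1 + \<psi> x)" if "0 \<le> x" for x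
  proof (cases "x \<le> a")
    case True
    also have "a \<le> a * (1 + \<psi> x)" using a nonneg[OF that] by simp
    finally show ?thesis .
  next
    case False
    have "\<psi> ((1 - a / x) *\<^sub>R 0 + (a / x) *\<^sub>R x) \<le> (1 - a / x) * \<psi> 0 + (a / x) * \<psi> x"
      using a False by (intro convex_onD[OF convex]) auto
    then have "\<psi> a \<le> a / x * \<psi> x" using a False zero by simp
    with a have "1 \<le> a / x * \<psi> x" by linarith
    then have "x \<le> a * \<psi> x" using a False by (simp add: field_simps)
    also have "\<dots> \<le> a * (1 + \<psi> x)" using a by (simp add: distrib_left)
    finally show ?thesis .
  qed
  then show ?thesis using a that[of a] by simp
qed

section \<open>The empirical norm as a function of the sample\<close>

text \<open>The empirical mean is nonincreasing and continuous in the scale and tends to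
  \<open>\<psi> 0 = 0\<close> as the scale grows. Hence the feasible scales form a nonempty up-set
  that is closed within the positive reals. This turns events about an infimum into events about
  sums. For \<open>n = 0\<close> the mean is 0 and both sides hold.\<close>

lemma empirical_le_iff:
  fixes x :: "nat \<Rightarrow> 'b::real_normed_vector"
  assumes s: "0 < s"
  shows "empirical_orlicz_norm \<psi> n x \<le> s \<longleftrightarrow> 1 / real n * (\<Sum>i<n. \<psi> (norm (x i) / s)) \<le> 1"
proof -
  define g where "g r = 1 / real n * (\<Sum>i<n. \<psi> (norm (x i) / r))" for r
  let ?A = "{r. 0 < r \<and> g r \<le> 1}"
  have bdd: "bdd_below ?A" by (rule bdd_belowI[of _ 0]) auto
  have g_anti: "g r' \<le> g r" if "0 < r" "r \<le> r'" for r r'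
    unfolding g_def using that by (intro mult_left_mono sum_mono scale_antimono) auto
  have g_cont: "isCont g s"
  proof -
    have "continuous_on {0<..} g"
      unfolding g_def
      by (intro continuous_intros continuous_on_compose2[OF cont]) auto
    then show ?thesis using s by (simp add: continuous_on_eq_continuous_at)
  qed
  have ne: "?A \<noteq> {}"
  proof -
    have "(g \<longlongrightarrow> 1 / real n * (\<Sum>i<n. \<psi> 0)) at_top"
      unfolding g_def
    proof (intro tendsto_intros)
      fix i
      show "((\<lambda>r. \<psi> (norm (x i) / r)) \<longlongrightarrow> \<psi> 0) at_top"
        by (rule continuous_on_tendsto_compose[OF cont])
           (auto intro!: real_tendsto_divide_at_top[where c="norm (x i)"] filterlim_ident eventually_at_top_linorderI[of 0])
    qed
    then have "eventually (\<lambda>r. g r < 1) at_top"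
      by (rule order_tendstoD) (simp add: zero)
    then have "eventually (\<lambda>r. 0 < r \<and> g r < 1) at_top"
      using eventually_gt_at_top[of 0] by eventually_elim auto
    then obtain r where "0 < r" "g r < 1" by (auto dest: eventually_happens)
    then show ?thesis by (auto intro!: exI[of _ r])
  qed
  have "Inf ?A \<le> s \<longleftrightarrow> g s \<le> 1"
  proof
    assume "g s \<le> 1"
    then show "Inf ?A \<le> s" using s bdd by (intro cInf_lower) auto
  next
    assume le: "Inf ?A \<le> s"
    show "g s \<le> 1"
    proof (rule ccontr)
      assume "\<not> g s \<le> 1"
      then have "eventually (\<lambda>r. 1 < g r) (at_right s)"
        using continuous_at_imp_continuous_within[OF g_cont, of "{s<..}"]
        by (intro order_tendstoD(1)[of g "g s"]) (auto simp: continuous_within)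
      then obtain b where b: "b > s" "\<And>r. s < r \<Longrightarrow> r < b \<Longrightarrow> 1 < g r"
        by (auto simp: eventually_at_right_field)
      have "Inf ?A < b" using le b by simp
      then obtain r where r: "0 < r" "g r \<le> 1" "r < b"
        using ne bdd by (auto simp: cInf_less_iff)
      \<comment> \<open>The feasible \<open>r\<close> is not known to exceed \<open>s\<close>, where
        the lower bound on \<open>g\<close> starts. Moving right to \<open>q\<close> keeps
        feasibility, since \<open>g\<close> is nonincreasing, and lands strictly between
        \<open>s\<close> and \<open>b\<close>.\<close>
      define q where "q = (max s r + b) / 2"
      have "s < q" "q < b" "r \<le> q" using r b by (auto simp: q_def)
      then show False using b(2)[of q] g_anti[of r q] r by auto
    qed
  qed
  then show ?thesis by (simp add: empirical_orlicz_norm_def g_def)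
qed

text \<open>A negative value would make every positive scale feasible, but the infimum of the
  positive reals is 0.\<close>

lemma empirical_nonneg:
  fixes x :: "nat \<Rightarrow> 'b::real_normed_vector"
  shows "0 \<le> empirical_orlicz_norm \<psi> n x"
proof (rule ccontr)
  assume neg: "\<not> ?thesis"
  let ?A = "{\<sigma>. 0 < \<sigma> \<and> 1 / real n * (\<Sum>i<n. \<psi> (norm (x i) / \<sigma>)) \<le> 1}"
  have "?A = {0<..}"
    using empirical_le_iff[of _ n x] neg by fastforce
  then show False using neg by (simp add: empirical_orlicz_norm_def)
qed

text \<open>Sublevel sets at positive levels are conditions on finite sums. Level 0 is the
  intersection of the levels 1/(k+1), and negative levels give the empty set.\<close>

lemma empirical_measurable:
  fixes Y :: "nat \<Rightarrow> 'c \<Rightarrow> 'b::real_normed_vector"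
  assumes [measurable]: "\<And>i. Y i \<in> borel_measurable N"
  shows "(\<lambda>\<omega>. empirical_orlicz_norm \<psi> n (\<lambda>i. Y i \<omega>)) \<in> borel_measurable N"
proof (rule borel_measurable_iff_le[THEN iffD2], rule allI)
  let ?f = "\<lambda>\<omega>. empirical_orlicz_norm \<psi> n (\<lambda>i. Y i \<omega>)"
  fix a :: real
  have pos: "{\<omega> \<in> space N. ?f \<omega> \<le> b} \<in> sets N" if "0 < b" for b
  proof -
    have [measurable]: "(\<lambda>\<omega>. \<psi> (norm (Y i \<omega>) / b)) \<in> borel_measurable N" for i
      using measurable_compose[OF _ measurable_norm[OF that]] by measurable
    show ?thesis unfolding empirical_le_iff[OF that] by measurable
  qed
  consider "a < 0" | "a = 0" | "0 < a" by linarith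
  then show "{\<omega> \<in> space N. ?f \<omega> \<le> a} \<in> sets N"
  proof cases
    case 1
    then have "{\<omega> \<in> space N. ?f \<omega> \<le> a} = {}"
      using empirical_nonneg[of n] by (force simp: not_le intro: less_le_trans)
    then show ?thesis by (simp only: sets.empty_sets)
  next
    case 2
    have "?f \<omega> \<le> 0 \<longleftrightarrow> (\<forall>k. ?f \<omega> \<le> 1 / real (Suc k))" for \<omega>
      by (metis nat_approx_posE less_eq_real_def linorder_not_le of_nat_0_less_iff order_less_trans zero_less_Suc zero_less_divide_1_iff)
    then have "{\<omega> \<in> space N. ?f \<omega> \<le> a} = (\<Inter>k. {\<omega> \<in> space N. ?f \<omega> \<le> 1 / real (Suc k)})"
      using 2 by auto
    also have "\<dots> \<in> sets N" using pos by (intro sets.countable_INT) auto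
    finally show ?thesis .
  qed (fact pos)
qed

section \<open>Moments of X near its Orlicz norm\<close>

context
  fixes M :: "'a measure" and X :: "'a \<Rightarrow> 'b::real_normed_vector" and s0 :: real
  assumes X: "X \<in> borel_measurable M" and s0: "0 < s0"
    and dom: "integrable M (\<lambda>\<omega>. norm (X \<omega>) * \<psi>' (norm (X \<omega>) / s0))"
begin

lemma measurable_scale:
  assumes "0 < s"
  shows "(\<lambda>\<omega>. \<psi> (norm (X \<omega>) / s)) \<in> borel_measurable M"
    "(\<lambda>\<omega>. \<psi>' (norm (X \<omega>) / s)) \<in> borel_measurable M"
  using measurable_compose[OF X measurable_norm[OF assms]]
    measurable_compose[OF X measurable_deriv_norm[OF assms]] by simp_all

lemma integrable_scale:
  assumes "s0 \<le> s"
  shows "integrable M (\<lambda>\<omega>. \<psi> (norm (X \<omega>) / s))"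
proof (rule Bochner_Integration.integrable_bound)
  show "integrable M (\<lambda>\<omega>. norm (X \<omega>) * \<psi>' (norm (X \<omega>) / s0) / s0)" using dom by simp
  show "AE \<omega> in M. norm (\<psi> (norm (X \<omega>) / s)) \<le> norm (norm (X \<omega>) * \<psi>' (norm (X \<omega>) / s0) / s0)"
  proof (rule AE_I2)
    fix \<omega>
    have "0 \<le> \<psi> (norm (X \<omega>) / s)" using assms s0 by (intro nonneg) simp
    moreover have "\<psi> (norm (X \<omega>) / s) \<le> norm (X \<omega>) * \<psi>' (norm (X \<omega>) / s0) / s0"
      using assms s0 by (intro le_scale_deriv) auto
    ultimately show "norm (\<psi> (norm (X \<omega>) / s)) \<le> norm (norm (X \<omega>) * \<psi>' (norm (X \<omega>) / s0) / s0)"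
      unfolding real_norm_def by linarith
  qed
  show "(\<lambda>\<omega>. \<psi> (norm (X \<omega>) / s)) \<in> borel_measurable M"
    using assms s0 by (intro measurable_scale) simp
qed

lemma integrable_scale_deriv:
  assumes "s0 \<le> s"
  shows "integrable M (\<lambda>\<omega>. norm (X \<omega>) * \<psi>' (norm (X \<omega>) / s))"
proof (rule Bochner_Integration.integrable_bound[OF dom])
  show "AE \<omega> in M. norm (norm (X \<omega>) * \<psi>' (norm (X \<omega>) / s))
      \<le> norm (norm (X \<omega>) * \<psi>' (norm (X \<omega>) / s0))"
  proof (rule AE_I2)
    fix \<omega>
    show "norm (norm (X \<omega>) * \<psi>' (norm (X \<omega>) / s)) \<le> norm (norm (X \<omega>) * \<psi>' (norm (X \<omega>) / s0))"
    proof (cases "norm (X \<omega>) = 0")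
      case False
      then show ?thesis using assms s0
        by (auto simp: abs_mult deriv_nonneg intro!: mult_left_mono deriv_mono divide_left_mono)
    qed simp
  qed
  show "(\<lambda>\<omega>. norm (X \<omega>) * \<psi>' (norm (X \<omega>) / s)) \<in> borel_measurable M"
    using assms s0 measurable_compose[OF X borel_measurable_norm]
    by (intro borel_measurable_times measurable_scale) simp_all
qed

text \<open>The room between \<open>s0\<close> and \<open>s\<close> makes the mean \<open>F\<close>
  finite and continuous on both sides of \<open>s\<close>. If \<open>F s > 1\<close>, scales
  slightly above \<open>s\<close> would be infeasible and the infimum would exceed \<open>s\<close>;
  if \<open>F s < 1\<close>, some scale below \<open>s\<close> would be feasible. The value 1 is the
  centring constant of the limit theorem.\<close>

lemma expectation_at_orlicz_norm:
  assumes norm: "orlicz_norm M \<psi> X = ennreal s" and s: "s0 < s"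
  shows "(\<integral>\<omega>. \<psi> (norm (X \<omega>) / s) \<partial>M) = 1"
proof -
  define F where "F r = (\<integral>\<omega>. \<psi> (norm (X \<omega>) / r) \<partial>M)" for r
  define C where "C = (\<integral>\<omega>. norm (X \<omega>) * \<psi>' (norm (X \<omega>) / s0) \<partial>M) / s0\<^sup>2"
  have F_nn: "(\<integral>\<^sup>+ \<omega>. ennreal (\<psi> (norm (X \<omega>) / r)) \<partial>M) = ennreal (F r)" if "s0 \<le> r" for r
    unfolding F_def using integrable_scale[OF that] that s0
    by (intro nn_integral_eq_integral AE_I2 nonneg) auto
  have lip: "\<bar>F r - F s\<bar> \<le> C * \<bar>r - s\<bar>" if "s0 \<le> r" for r
  proof -
    have "F r - F s = (\<integral>\<omega>. \<psi> (norm (X \<omega>) / r) - \<psi> (norm (X \<omega>) / s) \<partial>M)"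
      unfolding F_def using that s integrable_scale by simp
    also have "\<bar>\<dots>\<bar> \<le> (\<integral>\<omega>. \<bar>\<psi> (norm (X \<omega>) / r) - \<psi> (norm (X \<omega>) / s)\<bar> \<partial>M)"
      by (rule integral_abs_bound)
    also have "\<dots> \<le> (\<integral>\<omega>. \<bar>r - s\<bar> / s0\<^sup>2 * (norm (X \<omega>) * \<psi>' (norm (X \<omega>) / s0)) \<partial>M)"
      using that s s0 integrable_scale dom by (intro integral_mono scale_diff_le) auto
    also have "\<dots> = C * \<bar>r - s\<bar>"
      unfolding integral_mult_right_zero by (simp add: C_def)
    finally show ?thesis .
  qed
  have "(F \<longlongrightarrow> F s) (at s)"
  proof (rule LIM_zero_cancel, rule Lim_null_comparison)
    have "eventually (\<lambda>r. s0 < r) (at s)"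
      using order_tendstoD(1)[OF tendsto_ident_at[of s UNIV] s] .
    then show "eventually (\<lambda>r. norm (F r - F s) \<le> C * \<bar>r - s\<bar>) (at s)"
      by eventually_elim (use lip in auto)
    show "((\<lambda>r. C * \<bar>r - s\<bar>) \<longlongrightarrow> 0) (at s)"
      by (auto intro!: tendsto_eq_intros)
  qed
  then have right: "(F \<longlongrightarrow> F s) (at_right s)" and left: "(F \<longlongrightarrow> F s) (at_left s)"
    by (auto intro: tendsto_within_subset)
  have "F s = 1"
  proof (rule antisym)
    show "F s \<le> 1"
    proof (rule ccontr)
      assume "\<not> F s \<le> 1"
      then have "eventually (\<lambda>r. 1 < F r) (at_right s)"
        using right by (intro order_tendstoD) auto
      then obtain b where b: "b > s" "\<And>r. s < r \<Longrightarrow> r < b \<Longrightarrow> 1 < F r"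
        by (auto simp: eventually_at_right_field)
      define q where "q = (s + b) / 2"
      have q: "s < q" "1 < F q" using b by (auto simp: q_def)
      have "ennreal q \<le> orlicz_norm M \<psi> X"
        unfolding orlicz_norm_def
      proof (rule Inf_greatest, clarify)
        fix r assume r: "0 < r" "(\<integral>\<^sup>+ \<omega>. ennreal (\<psi> (norm (X \<omega>) / r)) \<partial>M) \<le> 1"
        show "ennreal q \<le> ennreal r"
        proof (rule ccontr)
          assume "\<not> ?thesis"
          then have "r < q" using r(1) by (simp add: not_le ennreal_less_iff)
          then have "ennreal (F q) \<le> (\<integral>\<^sup>+ \<omega>. ennreal (\<psi> (norm (X \<omega>) / r)) \<partial>M)"
            using q s r by (subst F_nn[symmetric]) (auto intro!: nn_integral_mono ennreal_leI scale_antimono)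
          from order_trans[OF this r(2)] have "ennreal (F q) \<le> 1" .
          with q show False by (simp add: ennreal_le_1)
        qed
      qed
      with norm q s s0 show False by (simp add: ennreal_le_iff2)
    qed
    show "1 \<le> F s"
    proof (rule ccontr)
      assume "\<not> 1 \<le> F s"
      then have "eventually (\<lambda>r. F r < 1) (at_left s)"
        using left by (intro order_tendstoD) auto
      then obtain b where b: "b < s" "\<And>r. b < r \<Longrightarrow> r < s \<Longrightarrow> F r < 1"
        by (auto simp: eventually_at_left_field)
      \<comment> \<open>Staying above \<open>s0\<close> ensures that the nonnegative integral at
        \<open>q\<close> is the finite mean \<open>F q\<close>.\<close>
      define q where "q = (max b s0 + s) / 2"
      have q: "q < s" "b < q" "s0 < q" using b s by (auto simp: q_def)
      have "orlicz_norm M \<psi> X \<le> ennreal q"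
        unfolding orlicz_norm_def
      proof (rule Inf_lower)
        show "ennreal q \<in> {ennreal r |r. 0 < r \<and> (\<integral>\<^sup>+ \<omega>. ennreal (\<psi> (norm (X \<omega>) / r)) \<partial>M) \<le> 1}"
          using q s0 b(2)[of q] F_nn[of q] by (auto intro!: exI[of _ q] simp: ennreal_le_1)
      qed
      with norm q s s0 show False by (simp add: ennreal_le_iff2)
    qed
  qed
  then show ?thesis by (simp add: F_def)
qed

end

text \<open>This is the delta method for a fixed \<open>u\<close>: by the chain rule the map from
  \<open>q\<close> to \<open>\<psi> (u / q)\<close> has derivative
  \<open>- (u / s^2) * \<psi>' (u / s)\<close> at \<open>s\<close>.\<close>

lemma scaled_difference_tendsto:
  assumes s: "0 < s" and u: "0 \<le> u" and r: "(\<lambda>n. sqrt (real n) * (r n - s)) \<longlonglongrightarrow> t"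
  shows "(\<lambda>n. sqrt (real n) * (\<psi> (u / r n) - \<psi> (u / s))) \<longlonglongrightarrow> - t * (u / s\<^sup>2 * \<psi>' (u / s))"
proof (cases "u = 0")
  case False
  with u s have us: "0 < u / s" by simp
  have "(\<psi> has_real_derivative \<psi>' (u / s)) (at (u / s))"
    using deriv[of "u / s"] us by (simp add: at_within_interior[of "u / s" "{0..}"])
  moreover have "((\<lambda>q. u / q) has_real_derivative - (u / s\<^sup>2)) (at s)"
    by (rule DERIV_cong[OF DERIV_divide[OF DERIV_const DERIV_ident]])
       (use s in \<open>simp_all add: power2_eq_square\<close>)
  ultimately have "((\<lambda>q. \<psi> (u / q)) has_real_derivative \<psi>' (u / s) * - (u / s\<^sup>2)) (at s)"
    by (rule DERIV_chain2)
  \<comment> \<open>Caratheodory's form of the derivative avoids difference quotients, whose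
    denominator \<open>r n - s\<close> may vanish.\<close>
  then obtain g where g: "\<And>q. \<psi> (u / q) - \<psi> (u / s) = g q * (q - s)" "isCont g s"
    "g s = \<psi>' (u / s) * - (u / s\<^sup>2)"
    unfolding CARAT_DERIV by auto
  have "eventually (\<lambda>n. 1 / sqrt (real n) * (sqrt (real n) * (r n - s)) = r n - s) sequentially"
    using eventually_gt_at_top[of 0] by eventually_elim simp
  moreover have "(\<lambda>n. 1 / sqrt (real n) * (sqrt (real n) * (r n - s))) \<longlonglongrightarrow> 0 * t"
    by (intro tendsto_mult r tendsto_divide_0[OF tendsto_const] filterlim_at_top_imp_at_infinity
        filterlim_compose[OF sqrt_at_top] filterlim_real_sequentially)
  ultimately have "(\<lambda>n. r n - s) \<longlonglongrightarrow> 0"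
    using Lim_transform_eventually by fastforce
  then have "r \<longlonglongrightarrow> s" by (rule LIM_zero_cancel)
  then have "(\<lambda>n. g (r n) * (sqrt (real n) * (r n - s))) \<longlonglongrightarrow> g s * t"
    using r by (intro tendsto_mult isCont_tendsto_compose[OF g(2)])
  then show ?thesis by (simp add: g(1,3) mult_ac)
qed simp

section \<open>Asymptotic normality\<close>

text \<open>The cdf is computed at each continuity point \<open>t\<close>: the event
  \<open>?Z n \<le> t\<close> eventually coincides with \<open>W n + R n \<le> a n\<close>, whose
  probability converges to the cdf of variance \<open>v\<close> at \<open>D * t\<close>. That is the
  cdf of variance \<open>v / D^2\<close> at \<open>t\<close>.\<close>

lemma empirical_orlicz_norm_clt:
  fixes Y :: "nat \<Rightarrow> 'c \<Rightarrow> 'b::real_normed_vector"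
  assumes iid: "iid_sequence N Y \<mu>" and s0: "0 < s0" "s0 < s"
    and dom: "integrable \<mu> (\<lambda>x. norm x * \<psi>' (norm x / s0))"
    and sq: "integrable \<mu> (\<lambda>x. (\<psi> (norm x / s))\<^sup>2)"
    and mean: "(\<integral>x. \<psi> (norm x / s) \<partial>\<mu>) = 1"
  shows "weak_conv_m
      (\<lambda>n. distr N borel (\<lambda>\<omega>. sqrt (real n) * (empirical_orlicz_norm \<psi> n (\<lambda>i. Y i \<omega>) - s)))
      (normal_distribution 0 (((\<integral>x. (\<psi> (norm x / s))\<^sup>2 \<partial>\<mu>) - 1) /
        (\<integral>x. norm x / s\<^sup>2 * \<psi>' (norm x / s) \<partial>\<mu>)\<^sup>2))"
proof -
  interpret iid_sequence N Y \<mu> by fact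
  have s: "0 < s" using s0 by simp
  have X: "(\<lambda>x. x) \<in> borel_measurable \<mu>" by simp
  note int = integrable_scale[OF X s0(1) dom] integrable_scale_deriv[OF X s0(1) dom]
  have [measurable]: "(\<lambda>x::'b. \<psi> (norm x / q)) \<in> borel_measurable borel" if "0 < q" for q
    using that by (rule measurable_norm)
  define v where "v = (\<integral>x. (\<psi> (norm x / s))\<^sup>2 \<partial>\<mu>) - 1"
  define D where "D = (\<integral>x. norm x / s\<^sup>2 * \<psi>' (norm x / s) \<partial>\<mu>)"
  have v: "\<mu>.variance (\<lambda>x. \<psi> (norm x / s)) = v"
    using sq int(1)[of s] s0 mean by (subst \<mu>.variance_eq) (auto simp: v_def)
  have v_nonneg: "0 \<le> v" unfolding v[symmetric] by (rule \<mu>.variance_positive)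
  have intD: "integrable \<mu> (\<lambda>x. norm x / s\<^sup>2 * \<psi>' (norm x / s))"
    using int(2)[of s] s0 by simp
  \<comment> \<open>As \<psi>(x) is at most x \<psi>'(x), the product \<open>s * D\<close> dominates
    the mean of \<psi>(|X|/s), which is 1.\<close>
  have D: "0 < D"
  proof -
    have "1 \<le> (\<integral>x. s * (norm x / s\<^sup>2 * \<psi>' (norm x / s)) \<partial>\<mu>)"
      unfolding mean[symmetric]
    proof (rule integral_mono)
      show "\<psi> (norm x / s) \<le> s * (norm x / s\<^sup>2 * \<psi>' (norm x / s))" for x :: 'b
        using le_deriv[of "norm x / s"] s by (simp add: power2_eq_square)
      show "integrable \<mu> (\<lambda>x. \<psi> (norm x / s))" using int(1) s0 by simp
    qed (rule integrable_mult_right[OF intD])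
    then have "1 \<le> s * D" by (simp only: D_def integral_mult_right_zero)
    then show ?thesis using s by (smt (verit) mult_nonneg_nonpos)
  qed
  let ?emp = "\<lambda>n \<omega>. empirical_orlicz_norm \<psi> n (\<lambda>i. Y i \<omega>)"
  have emp [measurable]: "?emp n \<in> borel_measurable N" for n
    by (rule empirical_measurable) (rule measurable_Y)
  let ?Z = "\<lambda>n \<omega>. sqrt (real n) * (?emp n \<omega> - s)"
  have Z: "?Z n \<in> borel_measurable N" for n by measurable
  have scale: "cdf (normal_distribution 0 (v / D\<^sup>2)) t = cdf (normal_distribution 0 v) (D * t)" for t
    using cdf_normal_distribution_scale[of D "v / D\<^sup>2" t] D v_nonneg by simp
  have "(\<lambda>n. prob {\<omega> \<in> space N. ?Z n \<omega> \<le> t}) \<longlonglongrightarrow> cdf (normal_distribution 0 v) (D * t)"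
    if cont: "isCont (cdf (normal_distribution 0 (v / D\<^sup>2))) t" for t
  proof -
    \<comment> \<open>The truncation at \<open>s0\<close> is inactive for large \<open>n\<close>; it makes the domination hold for every \<open>n\<close>.\<close>
    define r where "r n = max s0 (s + t / sqrt (real n))" for n
    have r_ge: "s0 \<le> r n" for n by (simp add: r_def)
    then have r_pos: "0 < r n" for n using s0 less_le_trans by blast
    \<comment> \<open>Since \<open>s0 < s\<close>, truncating at \<open>s0\<close> can only bring
      \<open>r n\<close> closer to \<open>s\<close>. At \<open>n = 0\<close> the factor
      \<open>sqrt 0\<close> makes the bound trivial.\<close>
    have r_dist: "sqrt (real n) * \<bar>r n - s\<bar> \<le> \<bar>t\<bar>" for n
    proof (cases "n = 0")
      case False
      have "\<bar>r n - s\<bar> \<le> \<bar>t / sqrt (real n)\<bar>" using s0 unfolding r_def by linarith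
      then show ?thesis using False by (simp add: abs_divide field_simps)
    qed simp
    have r_ev: "eventually (\<lambda>n. 0 < n \<and> r n = s + t / sqrt (real n)) sequentially"
    proof -
      have "(\<lambda>n. s + t / sqrt (real n)) \<longlonglongrightarrow> s + 0"
        by (intro tendsto_add tendsto_const tendsto_divide_0[OF tendsto_const]
            filterlim_at_top_imp_at_infinity filterlim_compose[OF sqrt_at_top] filterlim_real_sequentially)
      then have "eventually (\<lambda>n. s0 < s + t / sqrt (real n)) sequentially"
        using s0 by (intro order_tendstoD) auto
      then show ?thesis using eventually_gt_at_top[of 0]
        by eventually_elim (auto simp: r_def)
    qed
    have r_lim: "(\<lambda>n. sqrt (real n) * (r n - s)) \<longlonglongrightarrow> t"
      by (rule tendsto_eventually, use r_ev in eventually_elim) auto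
    define f where "f n x = sqrt (real n) * (\<psi> (norm x / r n) - \<psi> (norm x / s))" for n and x :: 'b
    \<comment> \<open>The bound of \<open>scale_diff_le\<close>, with sqrt n |r n - s| replaced by
      its upper bound |t|; it is free of \<open>n\<close>.\<close>
    define g where "g x = \<bar>t\<bar> / s0\<^sup>2 * (norm x * \<psi>' (norm x / s0))" for x :: 'b
    have f_meas [measurable]: "f n \<in> borel_measurable borel" for n
      unfolding f_def[abs_def] using measurable_norm[OF r_pos[of n]] measurable_norm[OF s] by measurable
    have g_meas [measurable]: "g \<in> borel_measurable borel"
      unfolding g_def[abs_def] using measurable_deriv_norm[OF s0(1)] by measurable
    have g_int: "integrable \<mu> g" unfolding g_def[abs_def] using dom by simp
    have f_le: "\<bar>f n x\<bar> \<le> g x" for n x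
    proof -
      have G: "0 \<le> norm x * \<psi>' (norm x / s0)"
        using s0 by (cases "x = 0") (auto intro!: mult_nonneg_nonneg deriv_nonneg)
      have "\<bar>f n x\<bar> = sqrt (real n) * \<bar>\<psi> (norm x / r n) - \<psi> (norm x / s)\<bar>"
        by (simp add: f_def abs_mult)
      also have "\<dots> \<le> sqrt (real n) * (\<bar>r n - s\<bar> / s0\<^sup>2 * (norm x * \<psi>' (norm x / s0)))"
        using s0 r_ge[of n] by (intro mult_left_mono scale_diff_le) auto
      also have "\<dots> = (sqrt (real n) * \<bar>r n - s\<bar>) / s0\<^sup>2 * (norm x * \<psi>' (norm x / s0))" by simp
      also have "\<dots> \<le> g x"
        unfolding g_def using G r_dist[of n] by (intro mult_right_mono divide_right_mono) auto
      finally show ?thesis .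
    qed
    \<comment> \<open>The sum of \<psi>(|Y_i|/r_n) - 1, divided by sqrt n, is
      \<open>W n + R n - a n\<close>. The sign of \<open>a n\<close> is chosen so that it becomes
      the threshold, with limit \<open>D * t\<close>.\<close>
    define W where "W n \<omega> = (\<Sum>i<n. \<psi> (norm (Y i \<omega>) / s) - 1) / sqrt (real n)" for n \<omega>
    define R where "R n \<omega> = (\<Sum>i<n. f n (Y i \<omega>)) / real n - integral\<^sup>L \<mu> (f n)" for n \<omega>
    define a where "a n = - integral\<^sup>L \<mu> (f n)" for n
    have psi_meas: "(\<lambda>\<omega>. \<psi> (norm (Y i \<omega>) / q)) \<in> borel_measurable N" if "0 < q" for i q
      using measurable_compose[OF measurable_Y measurable_norm[OF that]] .
    have W_meas: "W n \<in> borel_measurable N" for n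
      unfolding W_def[abs_def] using psi_meas[OF s] by measurable
    have R_meas: "R n \<in> borel_measurable N" for n
      unfolding R_def[abs_def] by measurable
    have W_conv: "weak_conv_m (\<lambda>n. distr N borel (W n)) (normal_distribution 0 v)"
      using central_limit[OF measurable_norm[OF s] sq] unfolding v unfolding mean W_def[abs_def] .
    have R_conv: "(\<lambda>n. prob {\<omega> \<in> space N. \<epsilon> \<le> \<bar>R n \<omega>\<bar>}) \<longlonglongrightarrow> 0" if "0 < \<epsilon>" for \<epsilon>
      unfolding R_def using f_meas g_meas f_le g_int that by (rule weak_law_dominated)
    have "(\<lambda>n. integral\<^sup>L \<mu> (f n)) \<longlonglongrightarrow> (\<integral>x. - t * (norm x / s\<^sup>2 * \<psi>' (norm x / s)) \<partial>\<mu>)"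
    proof (rule integral_dominated_convergence[where w=g])
      show "AE x in \<mu>. (\<lambda>n. f n x) \<longlonglongrightarrow> - t * (norm x / s\<^sup>2 * \<psi>' (norm x / s))"
        unfolding f_def by (intro AE_I2 scaled_difference_tendsto s r_lim) simp
      show "(\<lambda>x. - t * (norm x / s\<^sup>2 * \<psi>' (norm x / s))) \<in> borel_measurable \<mu>"
        by (rule borel_measurable_times[OF borel_measurable_const borel_measurable_integrable[OF intD]])
    qed (use g_int f_le in auto)
    then have "(\<lambda>n. integral\<^sup>L \<mu> (f n)) \<longlonglongrightarrow> - t * D"
      by (simp only: D_def integral_mult_right_zero)
    from tendsto_minus[OF this] have a_lim: "a \<longlonglongrightarrow> D * t"
      by (simp add: a_def[abs_def] mult.commute)
    have cont': "isCont (cdf (normal_distribution 0 v)) (D * t)"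
    proof -
      have "cdf (normal_distribution 0 v) = (\<lambda>y. cdf (normal_distribution 0 (v / D\<^sup>2)) (y / D))"
        using D by (simp add: scale)
      moreover have "isCont (\<lambda>y. cdf (normal_distribution 0 (v / D\<^sup>2)) (y / D)) (D * t)"
        by (rule isCont_o2[where g="cdf (normal_distribution 0 (v / D\<^sup>2))"]) (use D cont in simp_all)
      ultimately show ?thesis by simp
    qed
    have lim: "(\<lambda>n. prob {\<omega> \<in> space N. W n \<omega> + R n \<omega> \<le> a n}) \<longlonglongrightarrow> cdf (normal_distribution 0 v) (D * t)"
      by (rule slutsky_cdf[OF W_meas R_meas normal_distribution_real_distribution[OF v_nonneg]
            W_conv R_conv a_lim cont'])
    have "eventually (\<lambda>n. prob {\<omega> \<in> space N. W n \<omega> + R n \<omega> \<le> a n}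
        = prob {\<omega> \<in> space N. ?Z n \<omega> \<le> t}) sequentially"
      using r_ev
    proof eventually_elim
      case (elim n)
      then have n: "0 < n" and r_n: "r n = s + t / sqrt (real n)" by auto
      have "?Z n \<omega> \<le> t \<longleftrightarrow> W n \<omega> + R n \<omega> \<le> a n" for \<omega>
      proof -
        define S where "S q = (\<Sum>i<n. \<psi> (norm (Y i \<omega>) / q))" for q
        have "?Z n \<omega> \<le> t \<longleftrightarrow> ?emp n \<omega> \<le> r n"
          using n by (simp add: r_n field_simps)
        also have "\<dots> \<longleftrightarrow> 1 / real n * S (r n) \<le> 1"
          unfolding S_def by (rule empirical_le_iff[OF r_pos])
        also have "\<dots> \<longleftrightarrow> (S (r n) - real n) / sqrt (real n) \<le> 0"
          using n by (simp add: divide_le_0_iff)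
        also have "(S (r n) - real n) / sqrt (real n) = W n \<omega> + R n \<omega> - a n"
        proof -
          have "(\<Sum>i<n. f n (Y i \<omega>)) = sqrt (real n) * (S (r n) - S s)"
            by (simp add: f_def S_def sum_subtractf flip: sum_distrib_left)
          \<comment> \<open>One factor cancels the sqrt n built into \<open>f n\<close>, which
            brings the mean of \<open>f n\<close> to the normalisation of
            \<open>W n\<close>.\<close>
          moreover have "real n = sqrt (real n) * sqrt (real n)" by simp
          ultimately have "(\<Sum>i<n. f n (Y i \<omega>)) / real n = (S (r n) - S s) / sqrt (real n)"
            using n by (metis mult_divide_mult_cancel_left_if of_nat_0_less_iff order_less_irrefl real_sqrt_gt_0_iff)
          moreover have "W n \<omega> = (S s - real n) / sqrt (real n)"
            by (simp add: W_def S_def sum_subtractf)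
          ultimately show ?thesis
            by (simp add: R_def a_def diff_divide_distrib)
        qed
        finally show ?thesis by simp
      qed
      then show ?case by simp
    qed
    with lim show ?thesis by (rule Lim_transform_eventually)
  qed
  then have "weak_conv_m (\<lambda>n. distr N borel (?Z n)) (normal_distribution 0 (v / D\<^sup>2))"
    unfolding weak_conv_m_def weak_conv_def cdf_distr[OF Z] scale by blast
  then show ?thesis unfolding v_def D_def .
qed

section \<open>The sufficient moment condition\<close>

text \<open>The first claim is monotonicity of \<psi>. For the second, with u = |X|/\<sigma>, the
  tangent at u over a unit step gives \<psi>'(u) \<le> \<psi>(u+1), and linear growth bounds u by a
  multiple of 1 + \<psi>(u+1). The product is at most quadratic in \<psi>(u+1).\<close>

lemma
  fixes X :: "'a \<Rightarrow> 'b::real_normed_vector"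
  assumes M: "prob_space M" and X: "X \<in> borel_measurable M" and \<sigma>: "0 < \<sigma>"
    and shifted: "integrable M (\<lambda>\<omega>. (\<psi> (norm (X \<omega>) / \<sigma> + 1))\<^sup>2)"
  shows integrable_square_scale:
      "\<sigma> \<le> s \<Longrightarrow> integrable M (\<lambda>\<omega>. (\<psi> (norm (X \<omega>) / s))\<^sup>2)"
    and integrable_norm_deriv:
      "integrable M (\<lambda>\<omega>. norm (X \<omega>) * \<psi>' (norm (X \<omega>) / \<sigma>))"
proof -
  interpret prob_space M by fact
  let ?u = "\<lambda>\<omega>. norm (X \<omega>) / \<sigma>"
  have u: "0 \<le> ?u \<omega>" for \<omega> using \<sigma> by simp
  {
    assume s: "\<sigma> \<le> s"
    show "integrable M (\<lambda>\<omega>. (\<psi> (norm (X \<omega>) / s))\<^sup>2)"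
    proof (rule Bochner_Integration.integrable_bound[OF shifted])
      show "(\<lambda>\<omega>. (\<psi> (norm (X \<omega>) / s))\<^sup>2) \<in> borel_measurable M"
        using measurable_compose[OF X measurable_norm, of s] \<sigma> s by simp
      show "AE \<omega> in M. norm ((\<psi> (norm (X \<omega>) / s))\<^sup>2) \<le> norm ((\<psi> (?u \<omega> + 1))\<^sup>2)"
      proof (rule AE_I2)
        fix \<omega>
        have "0 \<le> \<psi> (norm (X \<omega>) / s)" using \<sigma> s by (intro nonneg) auto
        moreover have "\<psi> (norm (X \<omega>) / s) \<le> \<psi> (?u \<omega>)"
          using \<sigma> s by (intro scale_antimono) auto
        moreover have "\<psi> (?u \<omega>) \<le> \<psi> (?u \<omega> + 1)" using u by (intro mono) auto
        ultimately show "norm ((\<psi> (norm (X \<omega>) / s))\<^sup>2) \<le> norm ((\<psi> (?u \<omega> + 1))\<^sup>2)"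
          by (simp add: power_mono)
      qed
    qed
  }
  obtain c where c: "0 \<le> c" "\<And>x. 0 \<le> x \<Longrightarrow> x \<le> c * (1 + \<psi> x)" using linear_growth by blast
  show "integrable M (\<lambda>\<omega>. norm (X \<omega>) * \<psi>' (norm (X \<omega>) / \<sigma>))"
  proof (rule Bochner_Integration.integrable_bound)
    show "integrable M (\<lambda>\<omega>. \<sigma> * c * (1 + 2 * (\<psi> (?u \<omega> + 1))\<^sup>2))" using shifted by simp
    show "(\<lambda>\<omega>. norm (X \<omega>) * \<psi>' (norm (X \<omega>) / \<sigma>)) \<in> borel_measurable M"
      using measurable_compose[OF X measurable_deriv_norm[OF \<sigma>]] measurable_compose[OF X borel_measurable_norm]
      by (intro borel_measurable_times) simp_all
    show "AE \<omega> in M. norm (norm (X \<omega>) * \<psi>' (norm (X \<omega>) / \<sigma>)) \<le> norm (\<sigma> * c * (1 + 2 * (\<psi> (?u \<omega> + 1))\<^sup>2))"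
    proof (rule AE_I2)
      fix \<omega>
      show "norm (norm (X \<omega>) * \<psi>' (norm (X \<omega>) / \<sigma>)) \<le> norm (\<sigma> * c * (1 + 2 * (\<psi> (?u \<omega> + 1))\<^sup>2))"
      proof (cases "X \<omega> = 0")
        case False
        then have pos: "0 < ?u \<omega>" using \<sigma> by simp
        define p where "p = \<psi> (?u \<omega> + 1)"
        have p: "0 \<le> p" using u by (auto simp: p_def intro: nonneg add_nonneg_nonneg)
        have d: "0 \<le> \<psi>' (?u \<omega>)" "\<psi>' (?u \<omega>) \<le> p"
          using tangent[OF pos, of "?u \<omega> + 1"] nonneg[of "?u \<omega>"] deriv_nonneg[OF pos] u by (auto simp: p_def)
        have "?u \<omega> \<le> c * (1 + \<psi> (?u \<omega>))" using u by (rule c)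
        also have "\<dots> \<le> c * (1 + p)"
          unfolding p_def using c u by (intro mult_left_mono add_left_mono mono) auto
        finally have "norm (X \<omega>) \<le> \<sigma> * (c * (1 + p))" using \<sigma> by (simp add: field_simps)
        then have "norm (X \<omega>) * \<psi>' (?u \<omega>) \<le> \<sigma> * (c * (1 + p)) * p"
          using d p c \<sigma> by (intro mult_mono) auto
        also have "\<dots> = \<sigma> * c * ((1 + p) * p)" by simp
        also have "\<dots> \<le> \<sigma> * c * (1 + 2 * p\<^sup>2)"
        proof (rule mult_left_mono)
          \<comment> \<open>The right side minus the left side is (p - 1)^2 + p.\<close>
          show "(1 + p) * p \<le> 1 + 2 * p\<^sup>2"
            using zero_le_power2[of "p - 1"] p by (simp add: power2_eq_square algebra_simps)
        qed (use \<sigma> c in simp)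
        finally show ?thesis using d c \<sigma> by (simp add: p_def abs_mult)
      qed simp
    qed
  qed
qed

end

theorem theorem3p1:
  fixes \<psi> \<psi>' :: "real \<Rightarrow> real"
    and M :: "'a measure" and X :: "'a \<Rightarrow> 'b::banach"
    and N :: "'c measure" and Xs :: "nat \<Rightarrow> 'c \<Rightarrow> 'b"
    and \<sigma>\<^sub>\<psi> :: real
  assumes orlicz: "orlicz_function \<psi>"
    and deriv: "\<And>x. 0 \<le> x \<Longrightarrow> (\<psi> has_real_derivative \<psi>' x) (at x within {0..})"
    and cont_deriv: "continuous_on {0..} \<psi>'"
    and prob_M: "prob_space M"
    and rv_X: "X \<in> borel_measurable M"
    and norm_X: "orlicz_norm M \<psi> X = ennreal \<sigma>\<^sub>\<psi>"
    and pos: "0 < \<sigma>\<^sub>\<psi>"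
    and prob_N: "prob_space N"
    and indep: "prob_space.indep_vars N (\<lambda>_. borel) Xs UNIV"
    and ident: "\<And>i. distr N borel (Xs i) = distr M borel X"
  shows
    "(integrable M (\<lambda>\<omega>. (\<psi> (norm (X \<omega>) / \<sigma>\<^sub>\<psi>))\<^sup>2) \<and>
      (\<exists>\<sigma>. 0 < \<sigma> \<and> \<sigma> < \<sigma>\<^sub>\<psi> \<and> integrable M (\<lambda>\<omega>. norm (X \<omega>) * \<psi>' (norm (X \<omega>) / \<sigma>)))
      \<longrightarrow>
      weak_conv_m
        (\<lambda>n. distr N borel
           (\<lambda>\<omega>. sqrt (real n) * (empirical_orlicz_norm \<psi> n (\<lambda>i. Xs i \<omega>) - \<sigma>\<^sub>\<psi>)))
        (normal_distribution 0
           (((\<integral>\<omega>. (\<psi> (norm (X \<omega>) / \<sigma>\<^sub>\<psi>))\<^sup>2 \<partial>M) - 1) /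
            (\<integral>\<omega>. norm (X \<omega>) / \<sigma>\<^sub>\<psi>\<^sup>2 * \<psi>' (norm (X \<omega>) / \<sigma>\<^sub>\<psi>) \<partial>M)\<^sup>2)))
     \<and>
     ((\<exists>\<sigma>. 0 < \<sigma> \<and> \<sigma> < \<sigma>\<^sub>\<psi> \<and> integrable M (\<lambda>\<omega>. (\<psi> (norm (X \<omega>) / \<sigma> + 1))\<^sup>2))
      \<longrightarrow>
      integrable M (\<lambda>\<omega>. (\<psi> (norm (X \<omega>) / \<sigma>\<^sub>\<psi>))\<^sup>2) \<and>
      (\<exists>\<sigma>. 0 < \<sigma> \<and> \<sigma> < \<sigma>\<^sub>\<psi> \<and> integrable M (\<lambda>\<omega>. norm (X \<omega>) * \<psi>' (norm (X \<omega>) / \<sigma>))))"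
proof -
  interpret smooth_orlicz \<psi> \<psi>'
    using orlicz deriv cont_deriv by unfold_locales
  \<comment> \<open>The sample and \<open>X\<close> may live on different probability spaces and
    share only their law. Moments are therefore moved to that law, and the limit variance is moved
    back to \<open>M\<close> by change of variables.\<close>
  have iid: "iid_sequence N Xs (distr M borel X)"
    using prob_N indep ident by (simp add: iid_sequence_def iid_sequence_axioms_def)
  have sq_meas: "(\<lambda>x::'b. (\<psi> (norm x / s))\<^sup>2) \<in> borel_measurable borel"
    and deriv_meas: "(\<lambda>x::'b. norm x * \<psi>' (norm x / s)) \<in> borel_measurable borel"
    and deriv_meas': "(\<lambda>x::'b. norm x / s\<^sup>2 * \<psi>' (norm x / s)) \<in> borel_measurable borel"
    if "0 < s" for s
    using measurable_norm[OF that, where 'b='b] measurable_deriv_norm[OF that, where 'b='b] by measurable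
  show ?thesis
  proof (intro conjI impI; elim conjE exE)
    fix \<sigma>
    assume sq: "integrable M (\<lambda>\<omega>. (\<psi> (norm (X \<omega>) / \<sigma>\<^sub>\<psi>))\<^sup>2)"
      and \<sigma>: "0 < \<sigma>" "\<sigma> < \<sigma>\<^sub>\<psi>"
      and dom: "integrable M (\<lambda>\<omega>. norm (X \<omega>) * \<psi>' (norm (X \<omega>) / \<sigma>))"
    have "(\<integral>x. \<psi> (norm x / \<sigma>\<^sub>\<psi>) \<partial>distr M borel X) = 1"
      using expectation_at_orlicz_norm[OF rv_X \<sigma>(1) dom norm_X \<sigma>(2)]
      by (subst integral_distr[OF rv_X measurable_norm[OF pos]])
    moreover have "integrable (distr M borel X) (\<lambda>x. (\<psi> (norm x / \<sigma>\<^sub>\<psi>))\<^sup>2)"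
      using sq by (subst integrable_distr_eq[OF rv_X sq_meas[OF pos]])
    moreover have "integrable (distr M borel X) (\<lambda>x. norm x * \<psi>' (norm x / \<sigma>))"
      using dom by (subst integrable_distr_eq[OF rv_X deriv_meas[OF \<sigma>(1)]])
    ultimately show "weak_conv_m
        (\<lambda>n. distr N borel
           (\<lambda>\<omega>. sqrt (real n) * (empirical_orlicz_norm \<psi> n (\<lambda>i. Xs i \<omega>) - \<sigma>\<^sub>\<psi>)))
        (normal_distribution 0
           (((\<integral>\<omega>. (\<psi> (norm (X \<omega>) / \<sigma>\<^sub>\<psi>))\<^sup>2 \<partial>M) - 1) /
            (\<integral>\<omega>. norm (X \<omega>) / \<sigma>\<^sub>\<psi>\<^sup>2 * \<psi>' (norm (X \<omega>) / \<sigma>\<^sub>\<psi>) \<partial>M)\<^sup>2))"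
      using empirical_orlicz_norm_clt[OF iid \<sigma>]
      by (simp only: integral_distr[OF rv_X sq_meas[OF pos]] integral_distr[OF rv_X deriv_meas'[OF pos]])
  next
    fix \<sigma>
    assume "0 < \<sigma>" "\<sigma> < \<sigma>\<^sub>\<psi>" "integrable M (\<lambda>\<omega>. (\<psi> (norm (X \<omega>) / \<sigma> + 1))\<^sup>2)"
    \<comment> \<open>The given \<sigma> itself is the witness for (ii); (i) is the square bound at
      the larger scale \<open>\<sigma>\<^sub>\<psi>\<close>.\<close>
    then show "integrable M (\<lambda>\<omega>. (\<psi> (norm (X \<omega>) / \<sigma>\<^sub>\<psi>))\<^sup>2)"
      and "\<exists>\<sigma>. 0 < \<sigma> \<and> \<sigma> < \<sigma>\<^sub>\<psi> \<and> integrable M (\<lambda>\<omega>. norm (X \<omega>) * \<psi>' (norm (X \<omega>) / \<sigma>))"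
      using integrable_square_scale[OF prob_M rv_X] integrable_norm_deriv[OF prob_M rv_X] by auto
  qed
qed

end
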